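(* Let $n\ge 0$ and let $x,y,u_1,u_2,u_3,u_4,f,g,t,\alpha,\beta$ be commuting variables. If $xy=u_1u_2$ and $x+y=u_3+u_4$, then $$A_n(u_1,u_2,u_3,u_4,f,g,t\,|\,\alpha,\beta)=A_n^{\mathrm{cyc}}\left(x,y,\frac{\alpha u_3+\beta u_4}{\alpha f+\beta g}\,t\,\Big|\,\alpha f+\beta g\right).$$
   Context: $\mathfrak{S}_m$ is the symmetric group on $[m]=\{1,\dots,m\}$; permutations are also written as words $\sigma=\sigma_1\cdots\sigma_m$, $\sigma_i=\sigma(i)$. Linear statistics: for $\sigma\in\mathfrak{S}_m$ put $\sigma_0=\sigma_{m+1}=0$. A letter $\sigma_i$ ($1\le i\le m$) is a valley if $\sigma_{i-1}>\sigma_i<\sigma_{i+1}$, a peak if $\sigma_{i-1}<\sigma_i>\sigma_{i+1}$, a double ascent if $\sigma_{i-1}<\sigma_i<\sigma_{i+1}$, a double descent if $\sigma_{i-1}>\sigma_i>\sigma_{i+1}$; their numbers are $\mathrm{val},\mathrm{pk},\mathrm{da},\mathrm{dd}$. A letter $\sigma_i$ is a left-to-right maximum if $\sigma_i>\sigma_j$ for all $1\le j<i$, and a right-to-left maximum if $\sigma_i>\sigma_j$ for all $i<j\le m$; their numbers are $\mathrm{lmax},\mathrm{rmax}$. $\mathrm{lmaxpk}$ (resp. $\mathrm{lmaxda}$) is the number of left-to-right maxima that are peaks (resp. double ascents); $\mathrm{rmaxpk}$ (resp. $\mathrm{rmaxdd}$) is the number of right-to-left maxima that are peaks (resp. double descents).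 Define $$A_n(u_1,u_2,u_3,u_4,f,g,t\,|\,\alpha,\beta)=\sum_{\sigma\in\mathfrak{S}_{n+1}}(u_1u_2)^{\mathrm{val}(\sigma)}u_3^{\mathrm{da}(\sigma)}u_4^{\mathrm{dd}(\sigma)}f^{\mathrm{lmaxpk}(\sigma)-1}g^{\mathrm{rmaxpk}(\sigma)-1}t^{\mathrm{lmaxda}(\sigma)+\mathrm{rmaxdd}(\sigma)}\alpha^{\mathrm{lmax}(\sigma)-1}\beta^{\mathrm{rmax}(\sigma)-1}.$$ Cyclic polynomial: $A_n^{\mathrm{cyc}}(x,y,t\,|\,\alpha)=\sum_{\sigma\in\mathfrak{S}_n}x^{\mathrm{exc}(\sigma)}y^{\mathrm{drop}(\sigma)}t^{\mathrm{fix}(\sigma)}\alpha^{\mathrm{cyc}(\sigma)}$ (equal to $1$ for $n=0$), where $\mathrm{exc},\mathrm{drop},\mathrm{fix}$ count the $i\in[n]$ with $i<\sigma(i)$, $i>\sigma(i)$, $i=\sigma(i)$ respectively, and $\mathrm{cyc}$ is the number of cycles (fixed points included). Since $\mathrm{fix}\le\mathrm{cyc}$, denominators $\alpha f+\beta g$ cancel and the right-hand side of the claim is understood as the resulting polynomial. *)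

theory Defs
  imports "HOL-Combinatorics.Orbits"
begin

text \<open>Permutations of \<open>{1..m}\<close> are functions \<open>\<sigma> :: nat \<Rightarrow> nat\<close> with \<open>\<sigma> permutes {1..m}\<close>.\<close>

definition letter :: "nat \<Rightarrow> (nat \<Rightarrow> nat) \<Rightarrow> nat \<Rightarrow> nat" where
  \<comment> \<open>\<open>\<sigma> permutes {1..m}\<close> gives \<open>\<sigma> (m + 1) = m + 1\<close>, so the boundary convention
      \<open>\<sigma>\<^sub>0 = \<sigma>\<^sub>m\<^sub>+\<^sub>1 = 0\<close> has to be imposed here.\<close>
  "letter m \<sigma> i = (if i \<in> {1..m} then \<sigma> i else 0)"

definition is_valley :: "nat \<Rightarrow> (nat \<Rightarrow> nat) \<Rightarrow> nat \<Rightarrow> bool" where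
  "is_valley m \<sigma> i \<longleftrightarrow> letter m \<sigma> (i - 1) > letter m \<sigma> i \<and> letter m \<sigma> i < letter m \<sigma> (i + 1)"

definition is_peak :: "nat \<Rightarrow> (nat \<Rightarrow> nat) \<Rightarrow> nat \<Rightarrow> bool" where
  "is_peak m \<sigma> i \<longleftrightarrow> letter m \<sigma> (i - 1) < letter m \<sigma> i \<and> letter m \<sigma> i > letter m \<sigma> (i + 1)"

definition is_double_ascent :: "nat \<Rightarrow> (nat \<Rightarrow> nat) \<Rightarrow> nat \<Rightarrow> bool" where
  "is_double_ascent m \<sigma> i \<longleftrightarrow>
     letter m \<sigma> (i - 1) < letter m \<sigma> i \<and> letter m \<sigma> i < letter m \<sigma> (i + 1)"

definition is_double_descent :: "nat \<Rightarrow> (nat \<Rightarrow> nat) \<Rightarrow> nat \<Rightarrow> bool" where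
  "is_double_descent m \<sigma> i \<longleftrightarrow>
     letter m \<sigma> (i - 1) > letter m \<sigma> i \<and> letter m \<sigma> i > letter m \<sigma> (i + 1)"

definition is_lmax :: "(nat \<Rightarrow> nat) \<Rightarrow> nat \<Rightarrow> bool" where
  "is_lmax \<sigma> i \<longleftrightarrow> (\<forall>j. 1 \<le> j \<and> j < i \<longrightarrow> \<sigma> i > \<sigma> j)"

definition is_rmax :: "nat \<Rightarrow> (nat \<Rightarrow> nat) \<Rightarrow> nat \<Rightarrow> bool" where
  "is_rmax m \<sigma> i \<longleftrightarrow> (\<forall>j. i < j \<and> j \<le> m \<longrightarrow> \<sigma> i > \<sigma> j)"

definition val :: "nat \<Rightarrow> (nat \<Rightarrow> nat) \<Rightarrow> nat" where
  "val m \<sigma> = card {i \<in> {1..m}. is_valley m \<sigma> i}"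

definition da :: "nat \<Rightarrow> (nat \<Rightarrow> nat) \<Rightarrow> nat" where
  "da m \<sigma> = card {i \<in> {1..m}. is_double_ascent m \<sigma> i}"

definition dd :: "nat \<Rightarrow> (nat \<Rightarrow> nat) \<Rightarrow> nat" where
  "dd m \<sigma> = card {i \<in> {1..m}. is_double_descent m \<sigma> i}"

definition lmax :: "nat \<Rightarrow> (nat \<Rightarrow> nat) \<Rightarrow> nat" where
  "lmax m \<sigma> = card {i \<in> {1..m}. is_lmax \<sigma> i}"

definition rmax :: "nat \<Rightarrow> (nat \<Rightarrow> nat) \<Rightarrow> nat" where
  "rmax m \<sigma> = card {i \<in> {1..m}. is_rmax m \<sigma> i}"

definition lmaxpk :: "nat \<Rightarrow> (nat \<Rightarrow> nat) \<Rightarrow> nat" where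
  "lmaxpk m \<sigma> = card {i \<in> {1..m}. is_lmax \<sigma> i \<and> is_peak m \<sigma> i}"

definition lmaxda :: "nat \<Rightarrow> (nat \<Rightarrow> nat) \<Rightarrow> nat" where
  "lmaxda m \<sigma> = card {i \<in> {1..m}. is_lmax \<sigma> i \<and> is_double_ascent m \<sigma> i}"

definition rmaxpk :: "nat \<Rightarrow> (nat \<Rightarrow> nat) \<Rightarrow> nat" where
  "rmaxpk m \<sigma> = card {i \<in> {1..m}. is_rmax m \<sigma> i \<and> is_peak m \<sigma> i}"

definition rmaxdd :: "nat \<Rightarrow> (nat \<Rightarrow> nat) \<Rightarrow> nat" where
  "rmaxdd m \<sigma> = card {i \<in> {1..m}. is_rmax m \<sigma> i \<and> is_double_descent m \<sigma> i}"

text \<open>The truncated subtractions below are genuine: the largest letter of a nonempty word is a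
  peak, a left-to-right maximum and a right-to-left maximum, so the four statistics concerned are
  at least 1.\<close>

definition A_lin ::
  "nat \<Rightarrow> 'a \<Rightarrow> 'a \<Rightarrow> 'a \<Rightarrow> 'a \<Rightarrow> 'a \<Rightarrow> 'a \<Rightarrow> 'a \<Rightarrow> 'a \<Rightarrow> 'a \<Rightarrow> 'a::comm_ring_1" where
  "A_lin n u1 u2 u3 u4 f g t \<alpha> \<beta> =
     (\<Sum>\<sigma> | \<sigma> permutes {1..n+1}.
        (u1 * u2) ^ val (n+1) \<sigma> * u3 ^ da (n+1) \<sigma> * u4 ^ dd (n+1) \<sigma>
        * f ^ (lmaxpk (n+1) \<sigma> - 1) * g ^ (rmaxpk (n+1) \<sigma> - 1)
        * t ^ (lmaxda (n+1) \<sigma> + rmaxdd (n+1) \<sigma>)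
        * \<alpha> ^ (lmax (n+1) \<sigma> - 1) * \<beta> ^ (rmax (n+1) \<sigma> - 1))"

definition exc :: "nat \<Rightarrow> (nat \<Rightarrow> nat) \<Rightarrow> nat" where
  "exc n \<sigma> = card {i \<in> {1..n}. i < \<sigma> i}"

definition drops :: "nat \<Rightarrow> (nat \<Rightarrow> nat) \<Rightarrow> nat" where
  "drops n \<sigma> = card {i \<in> {1..n}. i > \<sigma> i}"

definition fixpts :: "nat \<Rightarrow> (nat \<Rightarrow> nat) \<Rightarrow> nat" where
  "fixpts n \<sigma> = card {i \<in> {1..n}. \<sigma> i = i}"

definition cyc :: "nat \<Rightarrow> (nat \<Rightarrow> nat) \<Rightarrow> nat" where
  "cyc n \<sigma> = card (orbit \<sigma> ` {1..n})"

definition A_cyc :: "nat \<Rightarrow> 'a \<Rightarrow> 'a \<Rightarrow> 'a \<Rightarrow> 'a \<Rightarrow> 'a::comm_ring_1" where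
  "A_cyc n x y t \<alpha> =
     (\<Sum>\<sigma> | \<sigma> permutes {1..n}. x ^ exc n \<sigma> * y ^ drops n \<sigma> * t ^ fixpts n \<sigma> * \<alpha> ^ cyc n \<sigma>)"

text \<open>\<open>A_cyc_cancelled n x y p t q\<close> is the polynomial obtained from
  \<open>A_cyc n x y ((p / q) * t) q\<close> by cancelling the denominators \<open>q\<close>: each term
  \<open>((p / q) * t) ^ fix * q ^ cyc\<close> becomes \<open>(p * t) ^ fix * q ^ (cyc - fix)\<close>, where
  \<open>fix \<le> cyc\<close>.  It makes sense in every commutative ring, also where \<open>q\<close> is not invertible.\<close>

definition A_cyc_cancelled :: "nat \<Rightarrow> 'a \<Rightarrow> 'a \<Rightarrow> 'a \<Rightarrow> 'a \<Rightarrow> 'a \<Rightarrow> 'a::comm_ring_1" where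
  "A_cyc_cancelled n x y p t q =
     (\<Sum>\<sigma> | \<sigma> permutes {1..n}.
        x ^ exc n \<sigma> * y ^ drops n \<sigma> * (p * t) ^ fixpts n \<sigma> * q ^ (cyc n \<sigma> - fixpts n \<sigma>))"

lemma fixpts_le_cyc: "fixpts n \<sigma> \<le> cyc n \<sigma>"
  unfolding fixpts_def cyc_def
proof (rule card_inj_on_le)
  show "inj_on (orbit \<sigma>) {i \<in> {1..n}. \<sigma> i = i}"
  proof (rule inj_onI)
    fix i j assume "i \<in> {i \<in> {1..n}. \<sigma> i = i}" "j \<in> {i \<in> {1..n}. \<sigma> i = i}"
      "orbit \<sigma> i = orbit \<sigma> j"
    then show "i = j"
      using orbit_eq_singleton_iff[of \<sigma> i] orbit_eq_singleton_iff[of \<sigma> j] by simp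
  qed
qed auto

lemma A_cyc_eq_cancelled:
  fixes x y p t q r :: "'a::comm_ring_1"
  assumes "r * q = p"
  shows "A_cyc n x y (r * t) q = A_cyc_cancelled n x y p t q"
  unfolding A_cyc_def A_cyc_cancelled_def
proof (rule sum.cong[OF refl])
  fix \<sigma>
  have "q ^ cyc n \<sigma> = q ^ fixpts n \<sigma> * q ^ (cyc n \<sigma> - fixpts n \<sigma>)"
    using fixpts_le_cyc[of n \<sigma>] by (simp flip: power_add)
  then show "x ^ exc n \<sigma> * y ^ drops n \<sigma> * (r * t) ^ fixpts n \<sigma> * q ^ cyc n \<sigma> =
      x ^ exc n \<sigma> * y ^ drops n \<sigma> * (p * t) ^ fixpts n \<sigma> * q ^ (cyc n \<sigma> - fixpts n \<sigma>)"
    by (simp add: assms[symmetric] power_mult_distrib mult_ac)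
qed

corollary A_cyc_divide_eq_cancelled:
  fixes x y p t q :: "'a::field"
  assumes "q \<noteq> 0"
  shows "A_cyc n x y (p / q * t) q = A_cyc_cancelled n x y p t q"
  using assms by (intro A_cyc_eq_cancelled) simp

end

theory Submission
  imports Defs "HOL-Combinatorics.Multiset_Permutations" "HOL-Combinatorics.Cycles"
begin

text \<open>
  Both sides are exponentials of one and the same function on finite sets.

  Cut a word at its largest letter \<open>M\<close>.  The left-to-right maxima before \<open>M\<close> split the left part
  into blocks, each led by such a maximum.  A leader standing alone is a double ascent of weight
  \<open>\<alpha> * u3 * t\<close>.  Any other leader is a peak of weight \<open>\<alpha> * f\<close>, followed by a basin: a nonempty word
  between two higher letters.  The right part is the mirror image, with \<open>\<beta> * u4 * t\<close> and
  \<open>\<beta> * g\<close>.  Hence the sums over the left and the right parts are exponentials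
  (\<open>words_weight_left\<close>, \<open>words_weight_right\<close>), and for their product the block weights add
  (\<open>expo_add\<close>): a single leader weighs \<open>(\<alpha> * u3 + \<beta> * u4) * t\<close>, and a leader with a basin
  contributes \<open>\<alpha> * f + \<beta> * g\<close>.

  On the cyclic side a permutation is a set of cycles, each led by its largest element.  A fixed
  point is a leader standing alone, and any other cycle is a leader followed by a basin, where each
  ascent is an excedance of weight \<open>x\<close> and each descent a drop of weight \<open>y\<close>
  (\<open>sum_perm_weight\<close>).

  It remains to compare the two ways of weighing a basin: by valleys \<open>u1 * u2\<close>, double ascents
  \<open>u3\<close> and double descents \<open>u4\<close> in the linear polynomial, by the steps \<open>x\<close> and \<open>y\<close> in the cyclic
  one.  Cutting a basin at its largest letter gives the same recursion for both, and in it the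
  weights enter only through \<open>u1 * u2 = x * y\<close> and \<open>u3 + u4 = x + y\<close> (\<open>basin_sum_insert\<close>,
  \<open>words_weight_basin\<close>).
\<close>

section \<open>Set convolutions and the exponential formula\<close>

text \<open>The block containing the largest element of \<open>A\<close> consists of it and \<open>K\<close>, and the remaining
  elements are treated recursively.  If \<open>g K\<close> depends only on the size of \<open>K\<close>, the exponential
  generating function \<open>E\<close> of the result satisfies \<open>E' = G E\<close>, so that it is \<open>exp (\<integral>G)\<close>.  Working
  with sets in place of generating functions avoids binomial coefficients and the division by
  factorials, which a general commutative ring does not permit.\<close>

function expo :: "(nat set \<Rightarrow> 'a::comm_ring_1) \<Rightarrow> nat set \<Rightarrow> 'a" where
  "expo g A = (if finite A \<and> A \<noteq> {}
     then \<Sum>K\<in>Pow (A - {Max A}). g K * expo g (A - {Max A} - K) else 1)"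
  by auto
termination
proof (relation "measure (\<lambda>(g, A). card A)")
  fix g :: "nat set \<Rightarrow> 'a" and A K :: "nat set"
  assume "finite A \<and> A \<noteq> {}"
  then have "Max A \<in> A" "finite A" by simp_all
  then have "card (A - {Max A} - K) < card A"
    by (intro psubset_card_mono) blast+
  then show "((g, A - {Max A} - K), (g, A)) \<in> measure (\<lambda>(g, A). card A)"
    by simp
qed (rule wf_measure)

declare expo.simps [simp del]

lemma expo_empty [simp]: "expo g {} = 1"
  by (simp add: expo.simps)

lemma Max_insert_above:
  fixes m :: nat
  assumes "finite A" "\<And>k. k \<in> A \<Longrightarrow> k < m"
  shows "Max (insert m A) = m" "m \<notin> A" "insert m A - {m} = A"
proof -
  show "m \<notin> A" using assms(2) by blast
  then show "insert m A - {m} = A" by auto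
  show "Max (insert m A) = m"
    using assms by (intro Max_eqI) (auto intro: less_imp_le)
qed

lemma expo_insert:
  assumes "finite A" "\<And>k. k \<in> A \<Longrightarrow> k < m"
  shows "expo g (insert m A) = (\<Sum>K\<in>Pow A. g K * expo g (A - K))"
  using assms Max_insert_above[OF assms] by (subst expo.simps) simp

lemma finite_top_induct [consumes 1, case_names empty insert]:
  fixes A :: "nat set"
  assumes "finite A" and "P {}"
    and step: "\<And>m A. finite A \<Longrightarrow> (\<And>k. k \<in> A \<Longrightarrow> k < m) \<Longrightarrow>
                 (\<And>B. B \<subseteq> A \<Longrightarrow> P B) \<Longrightarrow> P (insert m A)"
  shows "P A"
  using assms(1)
proof (induction A rule: finite_psubset_induct)
  case (psubset A)
  show ?case
  proof (cases "A = {}")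
    case False
    have m: "Max A \<in> A" "\<And>k. k \<in> A - {Max A} \<Longrightarrow> k < Max A"
      using False psubset.hyps by (auto simp: less_le)
    have "P (insert (Max A) (A - {Max A}))"
      using psubset.hyps m by (intro step psubset.IH) auto
    then show ?thesis using m by (simp add: insert_absorb)
  qed (simp add: \<open>P {}\<close>)
qed

lemma sum_Pow_insert:
  fixes F :: "'b set \<Rightarrow> 'a::comm_monoid_add"
  assumes "finite A" "m \<notin> A"
  shows "(\<Sum>J\<in>Pow (insert m A). F J) = (\<Sum>J\<in>Pow A. F (insert m J)) + (\<Sum>J\<in>Pow A. F J)"
proof -
  have "inj_on (insert m) (Pow A)"
    using assms(2) by (intro inj_onI) (metis PowD insert_ident subsetD)
  moreover have "Pow A \<inter> insert m ` Pow A = {}" using assms(2) by auto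
  ultimately show ?thesis
    using assms(1) by (simp add: Pow_insert sum.union_disjoint sum.reindex add.commute)
qed

text \<open>Both sides run over the disjoint pairs of subsets of \<open>A\<close>; likewise in the next
  lemma, where the pair is given by its union and one of its members.\<close>

lemma sum_disjoint_pairs_swap:
  fixes F :: "'b set \<Rightarrow> 'b set \<Rightarrow> 'a::comm_monoid_add"
  assumes "finite A"
  shows "(\<Sum>J\<in>Pow A. \<Sum>K\<in>Pow (A - J). F J K) = (\<Sum>K\<in>Pow A. \<Sum>J\<in>Pow (A - K). F J K)"
  using assms by (simp add: sum.Sigma)
    (rule sum.reindex_bij_witness[where i = "\<lambda>(a, b). (b, a)" and j = "\<lambda>(a, b). (b, a)"]; auto)

lemma sum_nested_pairs:
  fixes F :: "'b set \<Rightarrow> 'b set \<Rightarrow> 'a::comm_monoid_add"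
  assumes "finite A"
  shows "(\<Sum>J\<in>Pow A. \<Sum>K\<in>Pow J. F K (J - K)) = (\<Sum>K\<in>Pow A. \<Sum>J\<in>Pow (A - K). F K J)"
proof -
  have "(\<Sum>J\<in>Pow A. \<Sum>K\<in>Pow J. F K (J - K))
      = (\<Sum>(J, K)\<in>Sigma (Pow A) Pow. F K (J - K))"
    using assms by (subst sum.Sigma) (auto intro: finite_subset)
  also have "\<dots> = (\<Sum>(K, J)\<in>(SIGMA K:Pow A. Pow (A - K)). F K J)"
    by (rule sum.reindex_bij_witness[where i = "\<lambda>(K, J). (J \<union> K, K)" and j = "\<lambda>(J, K). (K, J - K)"])
      (auto simp: Diff_partition)
  also have "\<dots> = (\<Sum>K\<in>Pow A. \<Sum>J\<in>Pow (A - K). F K J)"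
    using assms by (simp add: sum.Sigma)
  finally show ?thesis .
qed

text \<open>The rule \<open>exp (b + c) = exp b * exp c\<close>.  The proof is the product rule: the largest element
  lies either in the part \<open>J\<close> or in its complement, and removing its block from that part leaves
  a pair of parts of a smaller set.\<close>

lemma expo_add:
  assumes "finite A"
  shows "(\<Sum>J\<in>Pow A. expo b J * expo c (A - J)) = expo (\<lambda>K. b K + c K) A"
  using assms
proof (induction A rule: finite_top_induct)
  case (insert m A)
  have fin: "finite J" if "J \<subseteq> A" for J using that insert.hyps(1) finite_subset by blast
  have "m \<notin> A" using insert.hyps(2) by blast
  \<comment> \<open>Here \<open>m\<close> belongs to the first part.\<close>
  have left: "(\<Sum>J\<in>Pow A. expo b (insert m J) * expo c (insert m A - insert m J))
      = (\<Sum>K\<in>Pow A. b K * expo (\<lambda>K. b K + c K) (A - K))"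
  proof -
    have "(\<Sum>J\<in>Pow A. expo b (insert m J) * expo c (insert m A - insert m J))
        = (\<Sum>J\<in>Pow A. \<Sum>K\<in>Pow J. b K * expo b (J - K) * expo c (A - (K \<union> (J - K))))"
    proof (intro sum.cong refl)
      fix J assume "J \<in> Pow A"
      then have "expo b (insert m J) = (\<Sum>K\<in>Pow J. b K * expo b (J - K))"
        using insert.hyps(2) by (intro expo_insert) (auto intro: fin)
      moreover have "insert m A - insert m J = A - J" using \<open>m \<notin> A\<close> by auto
      moreover have "K \<union> (J - K) = J" if "K \<in> Pow J" for K using that by auto
      ultimately show "expo b (insert m J) * expo c (insert m A - insert m J)
          = (\<Sum>K\<in>Pow J. b K * expo b (J - K) * expo c (A - (K \<union> (J - K))))"
        by (simp add: sum_distrib_right del: Un_Diff_cancel)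
    qed
    also have "\<dots> = (\<Sum>K\<in>Pow A. \<Sum>J\<in>Pow (A - K). b K * expo b J * expo c (A - (K \<union> J)))"
      by (rule sum_nested_pairs[OF insert.hyps(1)])
    also have "\<dots> = (\<Sum>K\<in>Pow A. b K * (\<Sum>J\<in>Pow (A - K). expo b J * expo c (A - K - J)))"
    proof -
      have "A - (K \<union> J) = A - K - J" for K J by auto
      then show ?thesis by (simp add: sum_distrib_left mult.assoc)
    qed
    also have "\<dots> = (\<Sum>K\<in>Pow A. b K * expo (\<lambda>K. b K + c K) (A - K))"
      by (intro sum.cong refl) (simp add: insert.IH)
    finally show ?thesis .
  qed
  \<comment> \<open>Here \<open>m\<close> belongs to the second part.\<close>
  have right: "(\<Sum>J\<in>Pow A. expo b J * expo c (insert m A - J))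
      = (\<Sum>K\<in>Pow A. c K * expo (\<lambda>K. b K + c K) (A - K))"
  proof -
    have "(\<Sum>J\<in>Pow A. expo b J * expo c (insert m A - J))
        = (\<Sum>J\<in>Pow A. \<Sum>K\<in>Pow (A - J). c K * (expo b J * expo c (A - K - J)))"
    proof (intro sum.cong refl)
      fix J assume "J \<in> Pow A"
      then have "insert m A - J = insert m (A - J)" using \<open>m \<notin> A\<close> by auto
      moreover have "expo c (insert m (A - J)) = (\<Sum>K\<in>Pow (A - J). c K * expo c (A - J - K))"
        using insert.hyps by (intro expo_insert) auto
      moreover have "A - J - K = A - K - J" for K by auto
      ultimately show "expo b J * expo c (insert m A - J)
          = (\<Sum>K\<in>Pow (A - J). c K * (expo b J * expo c (A - K - J)))"
        by (simp add: sum_distrib_left mult_ac)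
    qed
    also have "\<dots> = (\<Sum>K\<in>Pow A. \<Sum>J\<in>Pow (A - K). c K * (expo b J * expo c (A - K - J)))"
      by (rule sum_disjoint_pairs_swap[OF insert.hyps(1)])
    also have "\<dots> = (\<Sum>K\<in>Pow A. c K * expo (\<lambda>K. b K + c K) (A - K))"
      by (intro sum.cong refl) (simp add: insert.IH flip: sum_distrib_left)
    finally show ?thesis .
  qed
  show ?case
    unfolding sum_Pow_insert[OF insert.hyps(1) \<open>m \<notin> A\<close>] left right
    by (simp add: expo_insert[OF insert.hyps] sum.distrib distrib_right)
qed simp

section \<open>Words split at their largest letter\<close>

lemma sum_words_insert:
  fixes F :: "'b list \<Rightarrow> 'a::comm_monoid_add"
  assumes "finite A" "m \<notin> A"
  shows "(\<Sum>w\<in>permutations_of_set (insert m A). F w)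
    = (\<Sum>K\<in>Pow A. \<Sum>u\<in>permutations_of_set K. \<Sum>v\<in>permutations_of_set (A - K). F (u @ m # v))"
proof -
  let ?T = "SIGMA K:Pow A. permutations_of_set K \<times> permutations_of_set (A - K)"
  let ?f = "\<lambda>(K :: 'b set, u, v). u @ m # v"
  have "bij_betw ?f ?T (permutations_of_set (insert m A))"
    unfolding bij_betw_def
  proof (intro conjI inj_onI equalityI subsetI)
    fix p q assume pq: "p \<in> ?T" "q \<in> ?T" "?f p = ?f q"
    obtain K u v K' u' v' where p: "p = (K, u, v)" and q: "q = (K', u', v')"
      by (metis prod_cases3)
    have "u @ m # v = u' @ m # v'" "m \<notin> set u" "m \<notin> set v" "m \<notin> set u'" "m \<notin> set v'"
      using pq assms by (auto simp: p q permutations_of_set_def)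
    then have "u = u'" "v = v'"
      by (simp_all add: append_Cons_eq_iff)
    then show "p = q" using pq by (auto simp: p q permutations_of_set_def)
  next
    fix w assume "w \<in> ?f ` ?T"
    then show "w \<in> permutations_of_set (insert m A)"
      using assms by (auto simp: permutations_of_set_def)
  next
    fix w assume w: "w \<in> permutations_of_set (insert m A)"
    then have "m \<in> set w" by (auto simp: permutations_of_set_def)
    then obtain u v where uv: "w = u @ m # v" by (meson split_list)
    then have "(set u, u, v) \<in> ?T"
      using w assms by (auto simp: permutations_of_set_def)
    then show "w \<in> ?f ` ?T" by (rule rev_image_eqI) (simp add: uv)
  qed
  then have "(\<Sum>w\<in>permutations_of_set (insert m A). F w) = (\<Sum>p\<in>?T. F (?f p))"
    by (simp add: sum.reindex_bij_betw)
  also have "\<dots> = (\<Sum>K\<in>Pow A. \<Sum>u\<in>permutations_of_set K. \<Sum>v\<in>permutations_of_set (A - K).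
      F (u @ m # v))"
    using assms(1) by (simp add: sum.Sigma sum.cartesian_product split_def)
  finally show ?thesis .
qed

lemma sum_Pow_ends:
  fixes F :: "'b set \<Rightarrow> 'a::comm_monoid_add"
  assumes "finite A" "A \<noteq> {}"
  shows "(\<Sum>K\<in>Pow A. F K) = F {} + F A + (\<Sum>K\<in>Pow A - {{}, A}. F K)"
proof -
  have "(\<Sum>K\<in>Pow A. F K) = (\<Sum>K\<in>Pow A - {{}, A}. F K) + (\<Sum>K\<in>{{}, A}. F K)"
    using assms by (intro sum.subset_diff) auto
  then show ?thesis using assms by (simp add: add_ac)
qed

section \<open>Words between two higher letters\<close>

fun step_weight :: "'a \<Rightarrow> 'a \<Rightarrow> nat list \<Rightarrow> 'a::comm_ring_1" where
  "step_weight x y (a # b # w) = (if a < b then x else y) * step_weight x y (b # w)"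
| "step_weight x y w = 1"

lemma step_weight_append:
  "step_weight x y (u @ a # v) = step_weight x y (u @ [a]) * step_weight x y (a # v)"
  by (induction u rule: step_weight.induct[of _ undefined undefined]) (auto simp: mult.assoc)

lemma step_weight_down:
  assumes "w \<noteq> []" "\<forall>k\<in>set w. k < m"
  shows "step_weight x y (m # w) = y * step_weight x y w"
  using assms by (cases w) auto

lemma step_weight_up:
  assumes "w \<noteq> []" "\<forall>k\<in>set w. k < m"
  shows "step_weight x y (w @ [m]) = step_weight x y w * x"
  using assms by (induction w rule: step_weight.induct[of _ x y]) (auto simp: mult.assoc)

text \<open>A basin is a nonempty word whose two neighbours are higher than all its letters.  It is
  entered by a descent, of weight \<open>y\<close>, and left by an ascent, of weight \<open>x\<close>, which is all that
  the two neighbours contribute.\<close>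

definition basin_sum :: "'a \<Rightarrow> 'a \<Rightarrow> nat set \<Rightarrow> 'a::comm_ring_1" where
  "basin_sum x y K = (\<Sum>w\<in>permutations_of_set K. y * step_weight x y w * x)"

lemma basin_sum_singleton: "basin_sum x y {m} = x * y"
  by (simp add: basin_sum_def mult.commute)

text \<open>The largest letter of a basin cuts it into two basins, and if one of these is empty then
  its two enclosing steps shrink to the single step \<open>y\<close> or \<open>x\<close>.  Together with
  \<open>basin_sum_singleton\<close> this determines the sum from \<open>x * y\<close> and \<open>x + y\<close> alone, which is where
  the two hypotheses on \<open>x\<close> and \<open>y\<close> come from.\<close>

lemma basin_sum_insert:
  assumes "finite A" "A \<noteq> {}" and top: "\<And>k. k \<in> A \<Longrightarrow> k < m"
  shows "basin_sum x y (insert m A) = (x + y) * basin_sum x y A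
     + (\<Sum>K\<in>Pow A - {{}, A}. basin_sum x y K * basin_sum x y (A - K))"
proof -
  let ?S = "step_weight x y"
  define F where "F K = (\<Sum>u\<in>permutations_of_set K. \<Sum>v\<in>permutations_of_set (A - K).
      y * ?S (u @ m # v) * x)" for K
  have "m \<notin> A" using top by blast
  then have "basin_sum x y (insert m A) = (\<Sum>K\<in>Pow A. F K)"
    unfolding basin_sum_def F_def by (rule sum_words_insert[OF assms(1)])
  then have *: "basin_sum x y (insert m A) = F {} + F A + (\<Sum>K\<in>Pow A - {{}, A}. F K)"
    by (simp only: sum_Pow_ends[OF assms(1,2)])
  have down: "?S (m # v) = y * ?S v" if "v \<in> permutations_of_set K" "K \<subseteq> A" "K \<noteq> {}" for v K
    using that top by (intro step_weight_down) (auto simp: permutations_of_set_def)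
  have up: "?S (u @ [m]) = ?S u * x" if "u \<in> permutations_of_set K" "K \<subseteq> A" "K \<noteq> {}" for u K
    using that top by (intro step_weight_up) (auto simp: permutations_of_set_def)
  have "F {} = y * basin_sum x y A"
    using down assms by (simp add: F_def basin_sum_def sum_distrib_left mult_ac)
  moreover have "F A = x * basin_sum x y A"
    using up assms by (simp add: F_def basin_sum_def sum_distrib_left mult_ac)
  moreover have "F K = basin_sum x y K * basin_sum x y (A - K)" if "K \<in> Pow A - {{}, A}" for K
  proof -
    have K: "K \<subseteq> A" "K \<noteq> {}" "A - K \<subseteq> A" "A - K \<noteq> {}" using that by auto
    have "y * ?S (u @ m # v) * x = (y * ?S u * x) * (y * ?S v * x)"
      if "u \<in> permutations_of_set K" "v \<in> permutations_of_set (A - K)" for u v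
      by (subst step_weight_append)
        (simp add: up[OF that(1) K(1,2)] down[OF that(2) K(3,4)] mult_ac)
    then show ?thesis
      by (simp add: F_def basin_sum_def sum_product)
  qed
  ultimately show ?thesis by (simp add: * distrib_right)
qed

text \<open>The weight of a block with set of letters \<open>K\<close> below its leader: a leader standing alone
  weighs \<open>p\<close>, a leader followed by a nonempty basin contributes \<open>q\<close>.\<close>

definition block :: "'a \<Rightarrow> 'a \<Rightarrow> 'a \<Rightarrow> 'a \<Rightarrow> nat set \<Rightarrow> 'a::comm_ring_1" where
  "block x y p q K = (if K = {} then p else q * basin_sum x y K)"

lemma block_add: "block x y p q K + block x y p' q' K = block x y (p + p') (q + q') K"
  by (simp add: block_def distrib_right)

section \<open>Weights of letters in context\<close>

text \<open>The weight of a word standing between the letters \<open>ps\<close> and \<open>ss\<close>.  The four arguments of \<open>h\<close>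
  tell whether the step into the letter and the step out of it are ascents, and whether the letter
  is a left-to-right and a right-to-left maximum; the boundary letters are \<open>0\<close>.  In a word
  without repetitions the first two decide between valley, peak, double ascent and double
  descent.\<close>

fun word_weight :: "(bool \<Rightarrow> bool \<Rightarrow> bool \<Rightarrow> bool \<Rightarrow> 'a::comm_ring_1) \<Rightarrow>
    nat list \<Rightarrow> nat list \<Rightarrow> nat list \<Rightarrow> 'a" where
  "word_weight h ps [] ss = 1"
| "word_weight h ps (c # w) ss =
     h (last (0 # ps) < c) (c < hd (w @ ss @ [0])) (\<forall>k\<in>set ps. k < c) (\<forall>k\<in>set (w @ ss). k < c)
     * word_weight h (ps @ [c]) w ss"

lemma word_weight_append:
  "word_weight h ps (u @ w) ss = word_weight h ps u (w @ ss) * word_weight h (ps @ u) w ss"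
  by (induction u arbitrary: ps) (simp_all add: mult.assoc)

text \<open>A higher letter \<open>m\<close> hides everything behind it: it is the right neighbour of the
  last letter, and no letter before it can be a right-to-left maximum.\<close>

lemma word_weight_right_wall:
  assumes "\<forall>k\<in>set u. k < m"
  shows "word_weight h ps u (m # ss) = word_weight h ps u [m]"
  using assms
proof (induction u arbitrary: ps)
  case (Cons c u)
  have "hd (u @ (m # ss) @ [0]) = hd (u @ [m] @ [0])" by (cases u) auto
  moreover have "\<not> (\<forall>k\<in>set (u @ m # ss). k < c)" "\<not> (\<forall>k\<in>set (u @ [m]). k < c)"
    using Cons.prems by auto
  ultimately show ?case
    using Cons by (simp only: word_weight.simps) simp
qed simp

lemma word_weight_left_wall:
  assumes "\<forall>k\<in>set w. k < m"
  shows "word_weight h (ps @ m # qs) w ss = word_weight h (m # qs) w ss"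
  using assms
proof (induction w arbitrary: qs)
  case (Cons c w)
  have "\<not> (\<forall>k\<in>set (ps @ m # qs). k < c)" "\<not> (\<forall>k\<in>set (m # qs). k < c)"
    using Cons.prems by auto
  then show ?case
    using Cons.IH[of "qs @ [c]"] Cons.prems by (simp only: word_weight.simps) simp
qed simp

definition words_weight :: "(bool \<Rightarrow> bool \<Rightarrow> bool \<Rightarrow> bool \<Rightarrow> 'a::comm_ring_1) \<Rightarrow>
    nat list \<Rightarrow> nat set \<Rightarrow> nat list \<Rightarrow> 'a" where
  "words_weight h ps K ss = (\<Sum>w\<in>permutations_of_set K. word_weight h ps w ss)"

lemma words_weight_empty [simp]: "words_weight h ps {} ss = 1"
  by (simp add: words_weight_def)

text \<open>Cutting at the largest letter \<open>m\<close> decouples the two sides, since \<open>m\<close> is a wall for each of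
  them.  The kind of \<open>m\<close> depends only on which sides are empty: towards an empty side its neighbour
  is the surrounding letter, which is higher unless it is the boundary \<open>0\<close>.\<close>

lemma words_weight_insert:
  assumes "finite A" and top: "\<And>k. k \<in> A \<Longrightarrow> k < m" and "0 < m"
    and walls: "\<forall>k\<in>set ps. m < k" "\<forall>k\<in>set ss. m < k"
  shows "words_weight h ps (insert m A) ss = (\<Sum>J\<in>Pow A.
      words_weight h ps J [m]
      * h (J \<noteq> {} \<or> ps = []) (A - J = {} \<and> ss \<noteq> []) (ps = []) (ss = [])
      * words_weight h [m] (A - J) ss)"
proof -
  have "m \<notin> A" using top by blast
  have "word_weight h ps (u @ m # w) ss
      = word_weight h ps u [m] * h (J \<noteq> {} \<or> ps = []) (A - J = {} \<and> ss \<noteq> []) (ps = []) (ss = [])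
        * word_weight h [m] w ss"
    if J: "J \<subseteq> A" and u: "u \<in> permutations_of_set J" and w: "w \<in> permutations_of_set (A - J)"
    for J u w
  proof -
    have below: "\<forall>k\<in>set u. k < m" "\<forall>k\<in>set w. k < m"
      using u w J top by (auto simp: permutations_of_set_def)
    have empty: "u = [] \<longleftrightarrow> J = {}" "w = [] \<longleftrightarrow> A - J = {}"
      by (metis permutations_of_setD(1) u set_empty) (metis permutations_of_setD(1) w set_empty)
    have "(last (0 # ps @ u) < m) = (J \<noteq> {} \<or> ps = [])"
    proof (cases "u = []")
      case True
      then show ?thesis using walls(1) empty \<open>0 < m\<close> by (cases ps rule: rev_cases) auto
    next
      case False
      then show ?thesis using below(1) empty by auto
    qed
    moreover have "(m < hd (w @ ss @ [0])) = (A - J = {} \<and> ss \<noteq> [])"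
    proof (cases "w = []")
      case True
      then show ?thesis using walls(2) empty by (cases ss) auto
    next
      case False
      then have "hd w \<in> set w" by simp
      then have "hd w < m" using below(2) by blast
      then show ?thesis using empty False by auto
    qed
    moreover have "(\<forall>k\<in>set (ps @ u). k < m) = (ps = [])"
      using walls(1) below(1) by (cases ps) auto
    moreover have "(\<forall>k\<in>set (w @ ss). k < m) = (ss = [])"
      using walls(2) below(2) by (cases ss) auto
    ultimately show ?thesis
      using word_weight_right_wall[OF below(1), of h ps "w @ ss"]
        word_weight_left_wall[OF below(2), of h "ps @ u" "[]" ss]
      by (simp only: word_weight_append word_weight.simps append_Cons append_Nil append_assoc
          mult.assoc)
  qed
  then have "(\<Sum>u\<in>permutations_of_set J. \<Sum>w\<in>permutations_of_set (A - J).
        word_weight h ps (u @ m # w) ss)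
      = words_weight h ps J [m]
        * h (J \<noteq> {} \<or> ps = []) (A - J = {} \<and> ss \<noteq> []) (ps = []) (ss = [])
        * words_weight h [m] (A - J) ss" if "J \<in> Pow A" for J
    using that by (simp add: words_weight_def flip: sum_distrib_left sum_distrib_right)
  then show ?thesis
    using sum_words_insert[OF assms(1) \<open>m \<notin> A\<close>, of "\<lambda>w. word_weight h ps w ss"]
    by (simp add: words_weight_def)
qed

lemma sum_Pow_complement:
  "(\<Sum>J\<in>Pow A. F (A - J) J) = (\<Sum>K\<in>Pow A. F K (A - K))"
  by (rule sum.reindex_bij_witness[where i = "\<lambda>K. A - K" and j = "\<lambda>K. A - K"])
    (auto simp: double_diff)

context
  fixes z u3 u4 f g t \<alpha> \<beta> x y :: "'a::comm_ring_1"
begin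

text \<open>The letter that is a maximum in both directions, which is the largest letter of
  the whole word, receives neither \<open>\<alpha>\<close>, \<open>f\<close> nor \<open>\<beta>\<close>, \<open>g\<close>: this accounts for the
  subtracted ones in the exponents of the linear polynomial.  A left-to-right maximum is always
  entered by an ascent, so the step out of it tells a double ascent from a peak; dually on the
  right.\<close>

definition kind_weight :: "bool \<Rightarrow> bool \<Rightarrow> bool \<Rightarrow> bool \<Rightarrow> 'a" where
  "kind_weight up_in up_out l r =
     (if up_in then if up_out then u3 else 1 else if up_out then z else u4)
     * (if l \<and> \<not> r then \<alpha> * (if up_out then t else f) else 1)
     * (if r \<and> \<not> l then \<beta> * (if up_in then g else t) else 1)"

context
  assumes xy: "x * y = z" "x + y = u3 + u4"
begin

text \<open>No letter of a basin is a maximum in either direction, so only the kinds count.  The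
  sum obeys the recursion of \<open>basin_sum_insert\<close>, with \<open>u4 + u3\<close> in the place of \<open>x + y\<close> and with
  \<open>z\<close> as the weight of a single valley.\<close>

lemma words_weight_basin:
  assumes "finite K" "K \<noteq> {}" "0 \<notin> K"
    and "\<And>k. k \<in> K \<Longrightarrow> k < a" "\<And>k. k \<in> K \<Longrightarrow> k < b"
  shows "words_weight kind_weight [a] K [b] = basin_sum x y K"
  using assms
proof (induction K arbitrary: a b rule: finite_top_induct)
  case (insert m A)
  have m: "0 < m" "m < a" "m < b" using insert.prems by auto
  have IH: "words_weight kind_weight [c] J [d] = basin_sum x y J"
    if "J \<subseteq> A" "J \<noteq> {}" "c \<in> {a, m}" "d \<in> {b, m}" for J c d
    by (rule insert.IH) (use that insert.prems insert.hyps(2) in auto)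
  define F where "F J = words_weight kind_weight [a] J [m]
      * kind_weight (J \<noteq> {}) (A - J = {}) False False * words_weight kind_weight [m] (A - J) [b]" for J
  have *: "words_weight kind_weight [a] (insert m A) [b] = (\<Sum>J\<in>Pow A. F J)"
    unfolding F_def using words_weight_insert[OF insert.hyps, of "[a]" "[b]" kind_weight] m by simp
  show ?case
  proof (cases "A = {}")
    case True
    have "F {} = basin_sum x y {m}"
      by (simp add: F_def kind_weight_def basin_sum_singleton xy True)
    then show ?thesis using * True by simp
  next
    case False
    have "F {} = u4 * basin_sum x y A" "F A = u3 * basin_sum x y A"
      using False IH[of A] by (simp_all add: F_def kind_weight_def mult.commute)
    moreover have "F J = basin_sum x y J * basin_sum x y (A - J)" if "J \<in> Pow A - {{}, A}" for J
    proof -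
      have "J \<subseteq> A" "J \<noteq> {}" "A - J \<subseteq> A" "A - J \<noteq> {}" using that by auto
      then show ?thesis by (simp add: F_def kind_weight_def IH)
    qed
    ultimately show ?thesis
      using False insert.hyps
      by (simp add: * sum_Pow_ends basin_sum_insert xy distrib_right)
  qed
qed simp

text \<open>To the left of the largest letter of a word, each left-to-right maximum leads a
  block that ends before the next one.  The last block is led by the largest letter \<open>m\<close>: it is a
  double ascent if the block has no further letter, because the wall comes next, and a peak
  followed by a basin otherwise.\<close>

lemma words_weight_left:
  assumes "finite K" "0 \<notin> K" "\<And>k. k \<in> K \<Longrightarrow> k < b"
  shows "words_weight kind_weight [] K [b] = expo (block x y (\<alpha> * u3 * t) (\<alpha> * f)) K"
    (is "_ = expo ?L K")
  using assms
proof (induction K arbitrary: b rule: finite_top_induct)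
  case (insert m A)
  have m: "0 < m" "m < b" using insert.prems by auto
  have prefix: "words_weight kind_weight [] J [m] = expo ?L J" if "J \<subseteq> A" for J
    by (rule insert.IH) (use that insert.prems insert.hyps(2) in auto)
  have block: "kind_weight True (J = {}) True False * words_weight kind_weight [m] J [b] = ?L J"
    if "J \<subseteq> A" for J
  proof -
    have "words_weight kind_weight [m] J [b] = basin_sum x y J" if "J \<noteq> {}"
      by (rule words_weight_basin)
        (use that \<open>J \<subseteq> A\<close> insert.prems insert.hyps finite_subset[of J A] in auto)
    then show ?thesis by (simp add: block_def kind_weight_def mult_ac)
  qed
  have "words_weight kind_weight [] (insert m A) [b]
      = (\<Sum>J\<in>Pow A. words_weight kind_weight [] J [m]
          * (kind_weight True (A - J = {}) True False * words_weight kind_weight [m] (A - J) [b]))"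
    using words_weight_insert[OF insert.hyps, of "[]" "[b]" kind_weight] m by (simp add: mult.assoc)
  also have "\<dots> = (\<Sum>J\<in>Pow A. ?L (A - J) * expo ?L J)"
    by (intro sum.cong refl) (simp only: prefix block Diff_subset Pow_iff mult.commute)
  also have "\<dots> = (\<Sum>K\<in>Pow A. ?L K * expo ?L (A - K))"
    by (rule sum_Pow_complement)
  also have "\<dots> = expo ?L (insert m A)"
    by (rule expo_insert[OF insert.hyps, symmetric])
  finally show ?case .
qed simp

lemma words_weight_right:
  assumes "finite K" "0 \<notin> K" "\<And>k. k \<in> K \<Longrightarrow> k < a"
  shows "words_weight kind_weight [a] K [] = expo (block x y (\<beta> * u4 * t) (\<beta> * g)) K"
    (is "_ = expo ?R K")
  using assms
proof (induction K arbitrary: a rule: finite_top_induct)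
  case (insert m A)
  have m: "0 < m" "m < a" using insert.prems by auto
  have suffix: "words_weight kind_weight [m] J [] = expo ?R J" if "J \<subseteq> A" for J
    by (rule insert.IH) (use that insert.prems insert.hyps(2) in auto)
  have block: "words_weight kind_weight [a] J [m] * kind_weight (J \<noteq> {}) False False True = ?R J"
    if "J \<subseteq> A" for J
  proof -
    have "words_weight kind_weight [a] J [m] = basin_sum x y J" if "J \<noteq> {}"
      by (rule words_weight_basin)
        (use that \<open>J \<subseteq> A\<close> insert.prems insert.hyps finite_subset[of J A] in auto)
    then show ?thesis by (simp add: block_def kind_weight_def mult_ac)
  qed
  show ?case
    using words_weight_insert[OF insert.hyps, of "[a]" "[]" kind_weight] m insert.hyps
    by (simp add: expo_insert suffix block)
qed simp

text \<open>The largest letter has weight 1, and the words on its two sides are independent, so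
  that the exponents of the two exponentials add up.\<close>

lemma words_weight_all:
  assumes "finite A" "0 \<notin> A" "\<And>k. k \<in> A \<Longrightarrow> k < m" "0 < m"
  shows "words_weight kind_weight [] (insert m A) []
    = expo (block x y ((\<alpha> * u3 + \<beta> * u4) * t) (\<alpha> * f + \<beta> * g)) A"
proof -
  let ?L = "block x y (\<alpha> * u3 * t) (\<alpha> * f)"
  let ?R = "block x y (\<beta> * u4 * t) (\<beta> * g)"
  have "words_weight kind_weight [] (insert m A) []
      = (\<Sum>J\<in>Pow A. expo ?L J * expo ?R (A - J))"
  proof (subst words_weight_insert[OF assms(1,3,4)]; (intro sum.cong refl)?)
    fix J assume "J \<in> Pow A"
    then have "words_weight kind_weight [] J [m] = expo ?L J"
      "words_weight kind_weight [m] (A - J) [] = expo ?R (A - J)"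
      using assms finite_subset by (auto intro!: words_weight_left words_weight_right)
    then show "words_weight kind_weight [] J [m] * kind_weight (J \<noteq> {} \<or> [] = ([] :: nat list))
        (A - J = {} \<and> [] \<noteq> ([] :: nat list)) ([] = ([] :: nat list)) ([] = ([] :: nat list))
        * words_weight kind_weight [m] (A - J) [] = expo ?L J * expo ?R (A - J)"
      by (simp add: kind_weight_def)
  qed simp_all
  also have "\<dots> = expo (\<lambda>K. ?L K + ?R K) A"
    by (rule expo_add[OF assms(1)])
  finally show ?thesis by (simp add: block_add distrib_right)
qed

end

end

section \<open>Permutations as words\<close>

lemma bij_betw_permutes_words:
  "bij_betw (\<lambda>\<sigma>. map \<sigma> [1..<Suc m]) {\<sigma>. \<sigma> permutes {1..m}} (permutations_of_set {1..m})"
proof -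
  let ?f = "\<lambda>\<sigma> :: nat \<Rightarrow> nat. map \<sigma> [1..<Suc m]"
  let ?P = "{\<sigma>. \<sigma> permutes {1..m}}"
  have inj: "inj_on ?f ?P"
  proof (intro inj_onI ext)
    fix \<sigma> \<tau> i assume *: "\<sigma> \<in> ?P" "\<tau> \<in> ?P" "?f \<sigma> = ?f \<tau>"
    then have "\<forall>i\<in>{1..m}. \<sigma> i = \<tau> i" by auto
    then show "\<sigma> i = \<tau> i"
      using *(1,2) by (metis mem_Collect_eq permutes_not_in)
  qed
  have "?f \<sigma> \<in> permutations_of_set {1..m}" if "\<sigma> permutes {1..m}" for \<sigma>
  proof (rule permutations_of_setI)
    have "set (?f \<sigma>) = \<sigma> ` {1..m}"
      by (simp add: atLeastLessThanSuc_atLeastAtMost del: upt_Suc)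
    then show "set (?f \<sigma>) = {1..m}" using permutes_image[OF that] by simp
    show "distinct (?f \<sigma>)"
      using permutes_inj_on[OF that] by (simp add: distinct_map del: upt_Suc)
  qed
  then have "?f ` ?P \<subseteq> permutations_of_set {1..m}" by auto
  moreover have "card (?f ` ?P) = card (permutations_of_set {1..m})"
    unfolding card_image[OF inj] by (simp add: card_permutations)
  ultimately show ?thesis
    using inj by (simp add: bij_betw_def card_subset_eq del: upt_Suc)
qed

lemma word_weight_permutation_from:
  assumes "1 \<le> j" "j \<le> Suc m"
  shows "word_weight h (map \<sigma> [1..<j]) (map \<sigma> [j..<Suc m]) []
    = (\<Prod>i\<in>{j..m}. h (letter m \<sigma> (i - 1) < letter m \<sigma> i) (letter m \<sigma> i < letter m \<sigma> (i + 1))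
        (is_lmax \<sigma> i) (is_rmax m \<sigma> i))"
  using assms(2,1)
proof (induction j rule: inc_induct)
  case (step j)
  let ?u = "map \<sigma> [1..<j]" and ?v = "map \<sigma> [Suc j..<Suc m]"
  have j: "1 \<le> j" "j \<le> m" using step.hyps step.prems by auto
  have prev: "last (0 # ?u) = letter m \<sigma> (j - 1)"
  proof (cases "j = 1")
    case False
    then have "[1..<j] = [1..<j - 1] @ [j - 1]"
      using j upt_Suc_append[of 1 "j - 1"] by simp
    moreover have "j - 1 \<in> {1..m}" using False j by auto
    ultimately show ?thesis by (simp add: letter_def)
  qed (simp add: letter_def)
  have "next": "hd (?v @ [] @ [0]) = letter m \<sigma> (j + 1)"
  proof (cases "j = m")
    case False
    then have "[Suc j..<Suc m] = Suc j # [Suc (Suc j)..<Suc m]"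
      using j by (intro upt_conv_Cons) auto
    then show ?thesis using False j by (simp add: letter_def del: upt_Suc)
  qed (simp add: letter_def)
  have l: "(\<forall>k\<in>set ?u. k < \<sigma> j) = is_lmax \<sigma> j"
    by (auto simp: is_lmax_def)
  have r: "(\<forall>k\<in>set (?v @ []). k < \<sigma> j) = is_rmax m \<sigma> j"
    by (auto simp: is_rmax_def Ball_def simp del: upt_Suc)
  have at_j: "letter m \<sigma> j = \<sigma> j" using j by (simp add: letter_def)
  have "[j..<Suc m] = j # [Suc j..<Suc m]" using j by (intro upt_conv_Cons) auto
  moreover have "?u @ [\<sigma> j] = map \<sigma> [1..<Suc j]" using j by simp
  moreover have "{j..m} = insert j {Suc j..m}" using j by auto
  ultimately show ?case
    using step.IH prev "next" l r at_j by (simp only: list.map word_weight.simps) simp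
qed simp

corollary word_weight_permutation:
  "word_weight h [] (map \<sigma> [1..<Suc m]) []
    = (\<Prod>i\<in>{1..m}. h (letter m \<sigma> (i - 1) < letter m \<sigma> i) (letter m \<sigma> i < letter m \<sigma> (i + 1))
        (is_lmax \<sigma> i) (is_rmax m \<sigma> i))"
  using word_weight_permutation_from[of 1 m h \<sigma>] by (simp del: upt_Suc)

lemma power_card_eq_prod:
  assumes "finite S"
  shows "u ^ card {i \<in> S. P i} = (\<Prod>i\<in>S. if P i then u else (1 :: 'a::comm_ring_1))"
  using assms by (simp add: prod.If_cases Int_def)

text \<open>Each statistic becomes a product over positions.  The exponents that are
  diminished by one skip the position \<open>top\<close> of the largest letter, the only one that is both a
  left-to-right and a right-to-left maximum.\<close>

lemma linear_term_eq_word_weight: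
  fixes u1 u2 u3 u4 f g t \<alpha> \<beta> :: "'a::comm_ring_1"
  assumes \<sigma>: "\<sigma> permutes {1..n+1}"
  shows "(u1 * u2) ^ val (n+1) \<sigma> * u3 ^ da (n+1) \<sigma> * u4 ^ dd (n+1) \<sigma>
        * f ^ (lmaxpk (n+1) \<sigma> - 1) * g ^ (rmaxpk (n+1) \<sigma> - 1)
        * t ^ (lmaxda (n+1) \<sigma> + rmaxdd (n+1) \<sigma>)
        * \<alpha> ^ (lmax (n+1) \<sigma> - 1) * \<beta> ^ (rmax (n+1) \<sigma> - 1)
    = word_weight (kind_weight (u1 * u2) u3 u4 f g t \<alpha> \<beta>) [] (map \<sigma> [1..<Suc (n+1)]) []"
proof -
  define m where "m = n + 1"
  define up_in where "up_in i = (letter m \<sigma> (i - 1) < letter m \<sigma> i)" for i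
  define up_out where "up_out i = (letter m \<sigma> i < letter m \<sigma> (i + 1))" for i
  define l where "l = is_lmax \<sigma>"
  define r where "r = is_rmax m \<sigma>"
  define S where "S = {1..m}"
  have perm: "\<sigma> permutes S" and fin: "finite S" using \<sigma> by (auto simp: m_def S_def)
  have pos: "\<sigma> i \<in> S" if "i \<in> S" for i using that permutes_in_image[OF perm] by simp
  have inj: "\<sigma> i = \<sigma> j \<Longrightarrow> i = j" for i j using permutes_inj[OF perm] by (auto dest: injD)
  have ne: "letter m \<sigma> (i - 1) \<noteq> letter m \<sigma> i" "letter m \<sigma> (i + 1) \<noteq> letter m \<sigma> i"
    if "i \<in> S" for i
    using that pos[OF that] inj[of "i - 1" i] inj[of "i + 1" i]
    by (auto simp: letter_def S_def)
  have kinds: "is_valley m \<sigma> i = (\<not> up_in i \<and> up_out i)"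
    "is_peak m \<sigma> i = (up_in i \<and> \<not> up_out i)"
    "is_double_ascent m \<sigma> i = (up_in i \<and> up_out i)"
    "is_double_descent m \<sigma> i = (\<not> up_in i \<and> \<not> up_out i)" if "i \<in> S" for i
    using ne[OF that]
    by (auto simp: is_valley_def is_peak_def is_double_ascent_def is_double_descent_def
        up_in_def up_out_def)
  have l_up: "up_in i" if "i \<in> S" "l i" for i
    using that pos[OF that(1)]
    by (cases "i = 1") (auto simp: up_in_def l_def is_lmax_def letter_def S_def)
  have r_down: "\<not> up_out i" if "i \<in> S" "r i" for i
    using that by (auto simp: up_out_def r_def is_rmax_def letter_def S_def)
  have "m \<in> \<sigma> ` S" unfolding permutes_image[OF perm] by (simp add: S_def m_def)
  then obtain top where top: "top \<in> S" "\<sigma> top = m" by blast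
  have below: "\<sigma> i < m" if "i \<in> S" "i \<noteq> top" for i
  proof -
    have "\<sigma> i \<noteq> m" using inj[of i top] that(2) top(2) by auto
    then show ?thesis using pos[OF that(1)] by (simp add: S_def)
  qed
  have lr: "(l i \<and> r i) = (i = top)" if "i \<in> S" for i
  proof
    assume "l i \<and> r i"
    then have "i \<noteq> top \<Longrightarrow> m < \<sigma> i"
      using top by (cases i top rule: linorder_cases)
        (auto simp: l_def r_def is_lmax_def is_rmax_def S_def)
    then show "i = top" using below[OF that] by force
  next
    assume "i = top"
    then show "l i \<and> r i"
      using top below by (auto simp: l_def r_def is_lmax_def is_rmax_def S_def)
  qed
  have drop_top: "card {i \<in> S. P i} - 1 = card {i \<in> S. P i \<and> \<not> (l i \<and> r i)}" if "P top" for P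
  proof -
    have "{i \<in> S. P i \<and> \<not> (l i \<and> r i)} = {i \<in> S. P i} - {top}" using lr by auto
    then show ?thesis using top that fin by simp
  qed
  have top_kind: "l top" "r top" "up_in top" "\<not> up_out top"
    using lr[OF top(1)] l_up r_down top(1) by auto
  have cards: "val m \<sigma> = card {i \<in> S. \<not> up_in i \<and> up_out i}"
    "da m \<sigma> = card {i \<in> S. up_in i \<and> up_out i}"
    "dd m \<sigma> = card {i \<in> S. \<not> up_in i \<and> \<not> up_out i}"
    "lmaxda m \<sigma> = card {i \<in> S. l i \<and> up_in i \<and> up_out i}"
    "rmaxdd m \<sigma> = card {i \<in> S. r i \<and> \<not> up_in i \<and> \<not> up_out i}"
    "lmaxpk m \<sigma> = card {i \<in> S. l i \<and> up_in i \<and> \<not> up_out i}"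
    "rmaxpk m \<sigma> = card {i \<in> S. r i \<and> up_in i \<and> \<not> up_out i}"
    "lmax m \<sigma> = card {i \<in> S. l i}"
    "rmax m \<sigma> = card {i \<in> S. r i}"
    unfolding val_def da_def dd_def lmaxda_def rmaxdd_def lmaxpk_def rmaxpk_def lmax_def rmax_def
      S_def[symmetric] l_def[symmetric] r_def[symmetric]
    by (simp_all add: kinds cong: conj_cong)
  have drops:
    "lmaxpk m \<sigma> - 1 = card {i \<in> S. (l i \<and> up_in i \<and> \<not> up_out i) \<and> \<not> (l i \<and> r i)}"
    "rmaxpk m \<sigma> - 1 = card {i \<in> S. (r i \<and> up_in i \<and> \<not> up_out i) \<and> \<not> (l i \<and> r i)}"
    "lmax m \<sigma> - 1 = card {i \<in> S. l i \<and> \<not> (l i \<and> r i)}"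
    "rmax m \<sigma> - 1 = card {i \<in> S. r i \<and> \<not> (l i \<and> r i)}"
    unfolding cards by (rule drop_top, use top_kind in simp)+
  have "(u1 * u2) ^ val m \<sigma> * u3 ^ da m \<sigma> * u4 ^ dd m \<sigma>
        * f ^ (lmaxpk m \<sigma> - 1) * g ^ (rmaxpk m \<sigma> - 1) * t ^ (lmaxda m \<sigma> + rmaxdd m \<sigma>)
        * \<alpha> ^ (lmax m \<sigma> - 1) * \<beta> ^ (rmax m \<sigma> - 1)
    = (\<Prod>i\<in>S. kind_weight (u1 * u2) u3 u4 f g t \<alpha> \<beta> (up_in i) (up_out i) (l i) (r i))"
    unfolding drops cards(1-5) power_add power_card_eq_prod[OF fin] prod.distrib[symmetric]
  proof (rule prod.cong[OF refl], goal_cases)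
    case (1 i)
    have "l i \<longrightarrow> up_in i" "r i \<longrightarrow> \<not> up_out i" using 1 l_up r_down by auto
    then show ?case
      by (cases "up_in i"; cases "up_out i"; cases "l i"; cases "r i")
        (simp_all add: kind_weight_def mult_ac)
  qed
  then show ?thesis
    unfolding word_weight_permutation m_def[symmetric]
    by (simp add: S_def up_in_def up_out_def l_def r_def)
qed

section \<open>Permutations split at the cycle of the largest element\<close>

lemma orbit_along_word:
  assumes "map \<sigma> (a # w) = w @ [b]"
  shows "insert b (set w) \<subseteq> orbit \<sigma> a"
  using assms
proof (induction w arbitrary: a)
  case Nil
  then show ?case by (auto intro: orbit.base)
next
  case (Cons c w)
  then have "insert b (set w) \<subseteq> orbit \<sigma> (\<sigma> a)" "\<sigma> a = c" by auto
  then show ?case by (auto intro: orbit.base orbit_subset)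
qed

text \<open>The cycle is read off from \<open>a\<close> onwards, and \<open>m\<close> marks its end.\<close>

lemma cycle_word_unique:
  assumes "map \<sigma> (a # w) = w @ [m]" "map \<sigma> (a # w') = w' @ [m]" "m \<notin> set w" "m \<notin> set w'"
  shows "w = w'"
  using assms
proof (induction w arbitrary: a w')
  case Nil
  then show ?case by (cases w') auto
next
  case (Cons b v)
  then show ?case by (cases w') auto
qed

lemma cycle_word_no_fixpoint:
  assumes "map \<sigma> (a # w) = w @ [a]" "distinct (a # w)" "w \<noteq> []" "i \<in> set (a # w)"
  shows "\<sigma> i \<noteq> i"
proof
  assume fix_i: "\<sigma> i = i"
  let ?cs = "a # w"
  obtain j where j: "j < length ?cs" "?cs ! j = i" using assms(4) by (metis in_set_conv_nth)
  have "\<sigma> (?cs ! j) = map \<sigma> ?cs ! j" using j(1) by (rule nth_map[symmetric])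
  also have "map \<sigma> ?cs = rotate1 ?cs" using assms(1) by simp
  also have "rotate1 ?cs ! j = ?cs ! (Suc j mod length ?cs)" using j(1) by (rule nth_rotate1)
  finally have "?cs ! (Suc j mod length ?cs) = ?cs ! j" using j fix_i by simp
  then have "Suc j mod length ?cs = j"
    using assms(2) j(1) by (subst (asm) nth_eq_iff_index_eq) auto
  then show False using assms(3) j(1) by (cases "Suc j = length ?cs") auto
qed

lemma prod_cycle_word:
  assumes "map \<sigma> (a # w) = w @ [b]" "\<forall>i\<in>set (a # w). \<sigma> i \<noteq> i" "distinct (a # w)"
  shows "(\<Prod>i\<in>set (a # w). if i < \<sigma> i then x else if \<sigma> i < i then y else p)
    = step_weight x y (a # w @ [b])"
  using assms
proof (induction w arbitrary: a)
  case (Cons c w)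
  then show ?case by (auto simp: not_less_iff_gr_or_eq)
qed auto

text \<open>The cycle runs through \<open>m\<close> and then through the letters of \<open>w\<close> in order.  The set \<open>K\<close> of
  these letters indexes the sum over the triples.\<close>

definition cycle_join where
  "cycle_join m = (\<lambda>(K, w, \<tau>). cycle_of_list (m # w) \<circ> \<tau>)"

lemma cycle_of_list_word:
  assumes "distinct (m # w)"
  shows "map (cycle_of_list (m # w)) (m # w) = w @ [m]"
  using cyclic_rotation[OF assms, of 1] by simp

lemma cycle_join_props:
  assumes "m \<notin> A" "K \<subseteq> A" "w \<in> permutations_of_set K" "\<tau> permutes (A - K)"
  shows "cycle_join m (K, w, \<tau>) permutes insert m A"
    and "map (cycle_join m (K, w, \<tau>)) (m # w) = w @ [m]"
    and "\<And>i. i \<in> A - K \<Longrightarrow> cycle_join m (K, w, \<tau>) i = \<tau> i"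
proof -
  have w: "set w = K" "distinct (m # w)" "m \<notin> set w"
    using assms by (auto simp: permutations_of_set_def)
  have "cycle_of_list (m # w) permutes insert m A"
    using cycle_permutes[of "m # w"] w assms(2) by (auto intro: permutes_subset)
  moreover have "\<tau> permutes insert m A" using assms(4) by (rule permutes_subset) auto
  ultimately show "cycle_join m (K, w, \<tau>) permutes insert m A"
    unfolding cycle_join_def by (simp add: permutes_compose)
  have "\<tau> i = i" if "i \<in> set (m # w)" for i
    using that w assms(1) by (intro permutes_not_in[OF assms(4)]) auto
  then have "map (cycle_join m (K, w, \<tau>)) (m # w) = map (cycle_of_list (m # w)) (m # w)"
    by (intro map_cong refl) (simp only: cycle_join_def split comp_apply)
  then show "map (cycle_join m (K, w, \<tau>)) (m # w) = w @ [m]"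
    using cycle_of_list_word[OF w(2)] by (simp only:)
  fix i assume "i \<in> A - K"
  then have "\<tau> i \<in> A - K" using permutes_in_image[OF assms(4)] by simp
  then show "cycle_join m (K, w, \<tau>) i = \<tau> i"
    using w assms(1) by (simp add: cycle_join_def) (rule id_outside_supp, auto)
qed

text \<open>The word \<open>w\<close> is recovered by iterating the permutation from \<open>m\<close>, and \<open>\<tau>\<close> by undoing the cycle,
  which fixes \<open>m\<close> and all letters of \<open>w\<close>.\<close>

lemma bij_betw_cycle_join:
  assumes "finite A" "m \<notin> A"
  shows "bij_betw (cycle_join m)
    (SIGMA K:Pow A. permutations_of_set K \<times> {\<tau>. \<tau> permutes (A - K)})
    {\<sigma>. \<sigma> permutes insert m A}" (is "bij_betw _ ?T ?P")
  unfolding bij_betw_def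
proof (intro conjI inj_onI equalityI subsetI)
  fix c c' assume c: "c \<in> ?T" "c' \<in> ?T" "cycle_join m c = cycle_join m c'"
  obtain K w \<tau> K' w' \<tau>' where eq: "c = (K, w, \<tau>)" "c' = (K', w', \<tau>')" by (metis prod_cases3)
  have "m \<notin> set w" "m \<notin> set w'" using c assms by (auto simp: eq permutations_of_set_def)
  moreover have "map (cycle_join m c) (m # w) = w @ [m]"
    using c(1) assms(2) unfolding eq by (intro cycle_join_props(2)) auto
  moreover have "map (cycle_join m c) (m # w') = w' @ [m]"
    using c(2) assms(2) unfolding c(3) eq(2) by (intro cycle_join_props(2)) auto
  ultimately have "w = w'" by (metis cycle_word_unique)
  moreover from this have "K = K'" using c by (auto simp: eq permutations_of_set_def)
  moreover have "\<tau> = \<tau>'"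
  proof
    fix i
    have "cycle_of_list (m # w) (\<tau> i) = cycle_of_list (m # w) (\<tau>' i)"
      using fun_cong[OF c(3), of i] \<open>w = w'\<close> by (simp add: eq cycle_join_def)
    then show "\<tau> i = \<tau>' i"
      using permutes_inj[OF cycle_permutes[of "m # w"]] by (auto dest: injD)
  qed
  ultimately show "c = c'" by (simp add: eq)
next
  fix \<sigma> assume "\<sigma> \<in> cycle_join m ` ?T"
  then show "\<sigma> \<in> ?P" using cycle_join_props(1)[OF assms(2)] by auto
next
  fix \<sigma> assume "\<sigma> \<in> ?P"
  then have \<sigma>: "\<sigma> permutes insert m A" by simp
  then have perm: "permutation \<sigma>"
    unfolding permutation_permutes using assms(1) by (intro exI[of _ "insert m A"]) simp
  define L where "L = least_power \<sigma> m"
  have L: "(\<sigma> ^^ L) m = m" "0 < L"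
    unfolding L_def by (rule least_power_of_permutation[OF perm])+
  define w where "w = map (\<lambda>i. (\<sigma> ^^ i) m) [1..<L]"
  have support: "support \<sigma> m = m # w"
    using L(2) by (simp add: w_def L_def[symmetric] upt_conv_Cons)
  have dist: "distinct (m # w)" using cycle_of_permutation[OF perm, of m] support by simp
  have \<sigma>w: "map \<sigma> (m # w) = w @ [m]"
  proof -
    have "map \<sigma> (m # w) = map (\<lambda>i. (\<sigma> ^^ Suc i) m) [0..<L]"
      unfolding support[symmetric] L_def by simp
    also have "\<dots> = map (\<lambda>i. (\<sigma> ^^ i) m) (map Suc [0..<L])" by simp
    also have "\<dots> = map (\<lambda>i. (\<sigma> ^^ i) m) ([1..<L] @ [L])"
      using L(2) by (simp add: map_Suc_upt del: upt_Suc) (simp add: upt_Suc_append)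
    finally show ?thesis using L by (simp add: w_def)
  qed
  have "set w \<subseteq> insert m A"
  proof
    fix i assume "i \<in> set w"
    then obtain j where "i = (\<sigma> ^^ j) m" by (auto simp: w_def)
    then show "i \<in> insert m A"
      using permutes_in_image[OF permutes_funpow[OF \<sigma>]] by auto
  qed
  then have wA: "set w \<subseteq> A" using dist by auto
  let ?C = "cycle_of_list (m # w)"
  have C: "?C permutes insert m A"
    using cycle_permutes[of "m # w"] wA by (auto intro: permutes_subset)
  define \<tau> where "\<tau> = inv ?C \<circ> \<sigma>"
  have fixed: "\<tau> i = i" if "i \<in> set (m # w)" for i
  proof -
    have "map \<sigma> (m # w) = map ?C (m # w)" using \<sigma>w cycle_of_list_word[OF dist] by simp
    then have "\<sigma> i = ?C i" using that by (metis map_eq_conv)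
    then show ?thesis
      by (simp add: \<tau>_def) (metis C permutes_inverses(2))
  qed
  have "\<tau> permutes insert m A"
    unfolding \<tau>_def by (intro permutes_compose \<sigma> permutes_inv C)
  then have "\<tau> permutes A - set w"
    by (rule permutes_superset) (use fixed in auto)
  then have "(set w, w, \<tau>) \<in> ?T" using wA dist by auto
  moreover have "?C \<circ> \<tau> = \<sigma>"
    unfolding \<tau>_def by (simp add: o_assoc permutes_inv_o(1)[OF C])
  ultimately show "\<sigma> \<in> cycle_join m ` ?T"
    by (intro rev_image_eqI) (auto simp: cycle_join_def)
qed

text \<open>The factor \<open>q\<close> is given to the nontrivial cycles only, since \<open>p\<close> carries the full weight of
  a fixed point.\<close>

definition perm_weight :: "'a \<Rightarrow> 'a \<Rightarrow> 'a \<Rightarrow> 'a \<Rightarrow> nat set \<Rightarrow> (nat \<Rightarrow> nat) \<Rightarrow> 'a::comm_ring_1" where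
  "perm_weight x y p q A \<sigma> =
     (\<Prod>i\<in>A. if i < \<sigma> i then x else if \<sigma> i < i then y else p)
     * q ^ card (orbit \<sigma> ` {i \<in> A. \<sigma> i \<noteq> i})"

text \<open>Read from its largest element \<open>m\<close>, a nontrivial cycle is the word \<open>w\<close> between two copies
  of \<open>m\<close>: a basin, whose ascents are the excedances and whose descents are the drops of the
  cycle.\<close>

lemma perm_weight_cycle_join:
  assumes "finite A" and top: "\<And>k. k \<in> A \<Longrightarrow> k < m"
    and "K \<subseteq> A" "w \<in> permutations_of_set K" "\<tau> permutes (A - K)"
  shows "perm_weight x y p q (insert m A) (cycle_join m (K, w, \<tau>))
    = (if w = [] then p else q * (y * step_weight x y w * x)) * perm_weight x y p q (A - K) \<tau>"
proof -
  have mA: "m \<notin> A" using top by blast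
  define \<sigma> where "\<sigma> = cycle_join m (K, w, \<tau>)"
  note join = cycle_join_props[OF mA assms(3-5), folded \<sigma>_def]
  have w: "set w = K" "distinct (m # w)"
    using assms mA by (auto simp: permutations_of_set_def)
  have perm: "permutation \<sigma>"
    unfolding permutation_permutes using join(1) assms(1) by (intro exI[of _ "insert m A"]) simp
  have self: "i \<in> orbit \<sigma> i" for i by (rule permutation_self_in_orbit[OF perm])
  let ?s = "\<lambda>\<sigma> i. if i < \<sigma> i then x else if \<sigma> i < i then y else p"
  have split: "insert m A = set (m # w) \<union> (A - K)" "set (m # w) \<inter> (A - K) = {}"
    using w mA assms(3) by auto
  have prod: "prod (?s \<sigma>) (insert m A) = prod (?s \<sigma>) (set (m # w)) * prod (?s \<tau>) (A - K)"
  proof -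
    have "prod (?s \<sigma>) (A - K) = prod (?s \<tau>) (A - K)"
      using join(3) by (intro prod.cong refl) simp
    then show ?thesis
      unfolding split(1) using assms(1) split(2) by (subst prod.union_disjoint) simp_all
  qed
  have orbits: "orbit \<sigma> i = orbit \<tau> i" if "i \<in> A - K" for i
    using that join(3) permutes_in_image[OF assms(5)]
    by (intro orbit_cong0[of i "A - K"]) auto
  define N where "N = {i \<in> A - K. \<tau> i \<noteq> i}"
  have imN: "orbit \<sigma> ` N = orbit \<tau> ` N"
    using orbits by (intro image_cong) (auto simp: N_def)
  have "perm_weight x y p q (insert m A) \<sigma>
    = (if w = [] then p else q * (y * step_weight x y w * x)) * perm_weight x y p q (A - K) \<tau>"
  proof (cases "w = []")
    case True
    then have "\<sigma> m = m" "K = {}" using join(2) w by auto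
    then have "{i \<in> insert m A. \<sigma> i \<noteq> i} = N" using join(3) by (auto simp: N_def)
    then show ?thesis
      using True \<open>\<sigma> m = m\<close> prod imN
      by (simp add: perm_weight_def N_def mult.assoc)
  next
    case False
    have moved: "\<forall>i\<in>set (m # w). \<sigma> i \<noteq> i"
      using cycle_word_no_fixpoint[OF join(2) w(2) False] by blast
    have "step_weight x y (m # w @ [m]) = y * step_weight x y (w @ [m])"
      using False w(1) assms(3) top by (cases w) (auto dest: less_asym)
    also have "step_weight x y (w @ [m]) = step_weight x y w * x"
      using False w(1) assms(3) top by (intro step_weight_up) auto
    finally have cycle: "prod (?s \<sigma>) (set (m # w)) = y * step_weight x y w * x"
      using prod_cycle_word[OF join(2) moved w(2), of x y p] by (simp only: mult.assoc)
    have nontrivial: "{i \<in> insert m A. \<sigma> i \<noteq> i} = set (m # w) \<union> N"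
      unfolding split(1) using moved join(3) by (auto simp: N_def)
    have same: "orbit \<sigma> i = orbit \<sigma> m" if "i \<in> set (m # w)" for i
    proof -
      have "i \<in> orbit \<sigma> m" using that orbit_along_word[OF join(2)] by auto
      then show ?thesis by (rule orbit_cyclic_eq3[OF cyclic_on_orbit'[OF perm]])
    qed
    have "orbit \<sigma> ` set (m # w) = (\<lambda>_. orbit \<sigma> m) ` set (m # w)"
      by (intro image_cong refl same)
    then have one: "orbit \<sigma> ` set (m # w) = {orbit \<sigma> m}" by auto
    have image: "orbit \<sigma> ` {i \<in> insert m A. \<sigma> i \<noteq> i} = insert (orbit \<sigma> m) (orbit \<tau> ` N)"
      unfolding nontrivial image_Un one imN by simp
    have "orbit \<sigma> m \<notin> orbit \<tau> ` N"
    proof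
      assume "orbit \<sigma> m \<in> orbit \<tau> ` N"
      then obtain i where "i \<in> A - K" "orbit \<sigma> m = orbit \<tau> i" by (auto simp: N_def)
      then have "m \<in> A - K" using self[of m] permutes_orbit_subset[OF assms(5)] by auto
      then show False using mA by simp
    qed
    moreover have "finite N" using assms(1) by (simp add: N_def)
    ultimately have count: "card (orbit \<sigma> ` {i \<in> insert m A. \<sigma> i \<noteq> i}) = Suc (card (orbit \<tau> ` N))"
      unfolding image by simp
    show ?thesis
      unfolding perm_weight_def count prod cycle N_def[symmetric]
      using False by (simp add: mult_ac)
  qed
  then show ?thesis by (simp only: \<sigma>_def)
qed

lemma sum_perm_weight_insert:
  assumes "finite A" and top: "\<And>k. k \<in> A \<Longrightarrow> k < m"
  shows "(\<Sum>\<sigma> | \<sigma> permutes insert m A. perm_weight x y p q (insert m A) \<sigma>)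
    = (\<Sum>K\<in>Pow A. block x y p q K * (\<Sum>\<tau> | \<tau> permutes (A - K). perm_weight x y p q (A - K) \<tau>))"
proof -
  have mA: "m \<notin> A" using top by blast
  let ?c = "\<lambda>w. if w = [] then p else q * (y * step_weight x y w * x)"
  have block: "(\<Sum>w\<in>permutations_of_set K. ?c w) = block x y p q K" for K
  proof (cases "K = {}")
    case False
    then have "(\<Sum>w\<in>permutations_of_set K. ?c w)
        = (\<Sum>w\<in>permutations_of_set K. q * (y * step_weight x y w * x))"
      by (intro sum.cong refl) (auto simp: permutations_of_set_def)
    then show ?thesis using False by (simp add: block_def basin_sum_def sum_distrib_left)
  qed (simp add: block_def)
  have fin: "finite {\<tau>. \<tau> permutes (A - K)}" for K
    using assms(1) by (simp add: finite_permutations)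
  have "(\<Sum>\<sigma> | \<sigma> permutes insert m A. perm_weight x y p q (insert m A) \<sigma>)
    = (\<Sum>c\<in>(SIGMA K:Pow A. permutations_of_set K \<times> {\<tau>. \<tau> permutes (A - K)}).
        perm_weight x y p q (insert m A) (cycle_join m c))"
    using bij_betw_cycle_join[OF assms(1) mA] by (rule sum.reindex_bij_betw[symmetric])
  also have "\<dots> = (\<Sum>(K, w, \<tau>)\<in>(SIGMA K:Pow A. permutations_of_set K \<times> {\<tau>. \<tau> permutes (A - K)}).
        ?c w * perm_weight x y p q (A - K) \<tau>)"
    using perm_weight_cycle_join[OF assms, of _ _ _ x y p q] by (intro sum.cong refl) auto
  also have "\<dots> = (\<Sum>K\<in>Pow A. (\<Sum>w\<in>permutations_of_set K. ?c w)
        * (\<Sum>\<tau> | \<tau> permutes (A - K). perm_weight x y p q (A - K) \<tau>))"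
    using assms(1) fin by (simp add: sum.Sigma[symmetric] sum.cartesian_product[symmetric] sum_product)
  finally show ?thesis by (simp only: block)
qed

text \<open>A permutation is a set of cycles, each led by its largest element.\<close>

lemma sum_perm_weight:
  assumes "finite A"
  shows "(\<Sum>\<sigma> | \<sigma> permutes A. perm_weight x y p q A \<sigma>) = expo (block x y p q) A"
  using assms
proof (induction A rule: finite_top_induct)
  case empty
  then show ?case by (simp add: perm_weight_def)
next
  case (insert m A)
  then show ?case
    by (simp add: sum_perm_weight_insert expo_insert)
qed

lemma A_cyc_cancelled_eq_expo:
  "A_cyc_cancelled n x y p t q = expo (block x y (p * t) q) {1..n}"
proof -
  have "x ^ exc n \<sigma> * y ^ drops n \<sigma> * (p * t) ^ fixpts n \<sigma> * q ^ (cyc n \<sigma> - fixpts n \<sigma>)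
      = perm_weight x y (p * t) q {1..n} \<sigma>" if \<sigma>: "\<sigma> permutes {1..n}" for \<sigma>
  proof -
    let ?F = "{i \<in> {1..n}. \<sigma> i = i}" and ?N = "{i \<in> {1..n}. \<sigma> i \<noteq> i}"
    have single: "orbit \<sigma> i = {i}" if "\<sigma> i = i" for i
      using that by (simp add: orbit_eq_singleton_iff)
    have self: "i \<in> orbit \<sigma> i" for i
      using \<sigma> by (intro permutation_self_in_orbit) (auto simp: permutation_permutes)
    have "orbit \<sigma> ` {1..n} = orbit \<sigma> ` ?F \<union> orbit \<sigma> ` ?N" by auto
    moreover have "orbit \<sigma> ` ?F \<inter> orbit \<sigma> ` ?N = {}"
    proof -
      have "orbit \<sigma> i \<noteq> orbit \<sigma> j" if "i \<in> ?F" "j \<in> ?N" for i j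
        using that single[of i] self[of j] by auto
      then show ?thesis by blast
    qed
    moreover have "card (orbit \<sigma> ` ?F) = fixpts n \<sigma>"
      unfolding fixpts_def by (intro card_image inj_onI) (auto simp: single)
    ultimately have "cyc n \<sigma> - fixpts n \<sigma> = card (orbit \<sigma> ` ?N)"
      by (simp add: cyc_def card_Un_disjoint)
    moreover have "x ^ exc n \<sigma> * y ^ drops n \<sigma> * (p * t) ^ fixpts n \<sigma>
        = (\<Prod>i\<in>{1..n}. if i < \<sigma> i then x else if \<sigma> i < i then y else p * t)"
      unfolding exc_def drops_def fixpts_def power_card_eq_prod[OF finite_atLeastAtMost]
        prod.distrib[symmetric]
      by (intro prod.cong refl) auto
    ultimately show ?thesis by (simp add: perm_weight_def)
  qed
  then show ?thesis
    by (simp add: A_cyc_cancelled_def sum_perm_weight[symmetric])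
qed

section \<open>Comparison of the linear and the cyclic polynomial\<close>

theorem theorem1p2:
  fixes x y u1 u2 u3 u4 f g t \<alpha> \<beta> :: "'a::comm_ring_1" and n :: nat
  assumes "x * y = u1 * u2" and "x + y = u3 + u4"
  shows "A_lin n u1 u2 u3 u4 f g t \<alpha> \<beta> =
           A_cyc_cancelled n x y (\<alpha> * u3 + \<beta> * u4) t (\<alpha> * f + \<beta> * g)
       \<and> (\<forall>r. r * (\<alpha> * f + \<beta> * g) = \<alpha> * u3 + \<beta> * u4 \<longrightarrow>
           A_lin n u1 u2 u3 u4 f g t \<alpha> \<beta> = A_cyc n x y (r * t) (\<alpha> * f + \<beta> * g))"
proof -
  let ?h = "kind_weight (u1 * u2) u3 u4 f g t \<alpha> \<beta>"
  have "A_lin n u1 u2 u3 u4 f g t \<alpha> \<beta>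
      = (\<Sum>\<sigma> | \<sigma> permutes {1..n+1}. word_weight ?h [] (map \<sigma> [1..<Suc (n+1)]) [])"
    unfolding A_lin_def by (intro sum.cong refl linear_term_eq_word_weight) simp
  also have "\<dots> = words_weight ?h [] {1..n+1} []"
    unfolding words_weight_def
    by (rule sum.reindex_bij_betw[OF bij_betw_permutes_words])
  also have "{1..n+1} = insert (n + 1) {1..n}" by auto
  also have "words_weight ?h [] \<dots> []
      = expo (block x y ((\<alpha> * u3 + \<beta> * u4) * t) (\<alpha> * f + \<beta> * g)) {1..n}"
    using words_weight_all[OF assms, of "{1..n}" "n + 1" f g t \<alpha> \<beta>] by simp
  finally have "A_lin n u1 u2 u3 u4 f g t \<alpha> \<beta>
      = A_cyc_cancelled n x y (\<alpha> * u3 + \<beta> * u4) t (\<alpha> * f + \<beta> * g)"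
    by (simp only: A_cyc_cancelled_eq_expo)
  then show ?thesis by (simp add: A_cyc_eq_cancelled)
qed

end
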